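(* Let $K,L,k$ be non-negative integers such that $2K-L\le 2k\le 2K$, let $\alpha>0$, and let $\beta=\frac{1-\alpha}{2}$. Let $\gamma$ be a closed contour going around $0$ once in the positive direction. Let $P_k$ be the unique monic $2\times2$ matrix-valued polynomial of degree $k$ with $$\frac{1}{2\pi i}\oint_\gamma P_k(z)\frac{W_\alpha(z)^L}{z^K}z^j\,dz=0_2,\quad j=0,\ldots,k-1,\qquad W_\alpha(z)=\begin{pmatrix}\alpha & 1 \\ z & 1\end{pmatrix}.$$ (a) Then $$P_k(\zeta^2-\beta^2)\begin{pmatrix}1 & 1 \\ \zeta+\beta & -\zeta+\beta\end{pmatrix}=\begin{pmatrix}q_{2k}(\zeta) & q_{2k}(-\zeta) \\ q_{2k+1}(\zeta) & q_{2k+1}(-\zeta)\end{pmatrix},$$ where $q_{2k}$ and $q_{2k+1}$ are monic polynomials of degrees $2k$ and $2k+1$ respectively, satisfying $$\frac{1}{2\pi i}\oint_{\gamma_R}q_{2k+\epsilon}(\zeta)\,\zeta^j\,\frac{(\zeta+\alpha+\beta)^L}{(\zeta^2-\beta^2)^K}\,d\zeta=0,\qquad j=0,1,\ldots,2k-1,\quad \epsilon=0,1,\qquad(\ast)$$ where $\gamma_R$ is the positively oriented circle of radius $R>|\beta|$ around $0$. (b) Conversely, if $q_{2k}$ and $q_{2k+1}$ are monic polynomials of degrees $2k$ and $2k+1$ satisfying $(\ast)$, then with the constant $$c=\beta-\frac{1}{2\pi i}\oint_\gamma\frac{q_{2k+1}(\zeta)}{\zeta^{2k+1}}\,d\zeta$$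 and with $\zeta=(z+\beta^2)^{1/2}$ the principal branch of the square root (i.e. $\operatorname{Re}\zeta>0$), we have $$P_k(z)=\begin{pmatrix}1 & 0 \\ c & 1\end{pmatrix}\begin{pmatrix}q_{2k}(\zeta) & q_{2k}(-\zeta) \\ q_{2k+1}(\zeta) & q_{2k+1}(-\zeta)\end{pmatrix}\begin{pmatrix}1 & 1 \\ \zeta+\beta & -\zeta+\beta\end{pmatrix}^{-1}$$ $$=\begin{pmatrix}1 & 0 \\ c & 1\end{pmatrix}\begin{pmatrix}\frac{q_{2k}(\zeta)+q_{2k}(-\zeta)}{2} & \frac{q_{2k}(\zeta)-q_{2k}(-\zeta)}{2\zeta} \\[2pt] \frac{q_{2k+1}(\zeta)+q_{2k+1}(-\zeta)}{2} & \frac{q_{2k+1}(\zeta)-q_{2k+1}(-\zeta)}{2\zeta}\end{pmatrix}\begin{pmatrix}1 & 0 \\ -\beta & 1\end{pmatrix}.$$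
   Context: A monic matrix-valued polynomial of degree $k$ and size $2\times 2$ is $P_k(z)=z^kI_2+\sum_{i=0}^{k-1}C_iz^i$ with $C_i\in\mathbb{C}^{2\times2}$; integrals are taken entrywise. Existence and uniqueness of $P_k$ under the stated hypotheses is known and may be taken as given. *)

theory Defs
  imports "HOL-Complex_Analysis.Complex_Analysis"
begin

type_synonym cmat2 = "complex^2^2"

abbreviation mat2 :: "complex \<Rightarrow> complex \<Rightarrow> complex \<Rightarrow> complex \<Rightarrow> cmat2" where
  "mat2 a b c d \<equiv> vector [vector [a, b], vector [c, d]]"

text \<open>The library's \<open>^\<close> and \<open>*\<close> on \<^typ>\<open>complex^2^2\<close> act entrywise, and \<open>*s\<close> would take a
  vector as its scalar, so scalar multiples and powers for the matrix product \<open>**\<close> are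
  defined here.\<close>

definition mat_scale :: "complex \<Rightarrow> cmat2 \<Rightarrow> cmat2" (infixr \<open>*k\<close> 70) where
  "c *k A = (\<chi> i j. c * A $ i $ j)"

primrec matpow :: "cmat2 \<Rightarrow> nat \<Rightarrow> cmat2" where
  "matpow A 0 = mat 1"
| "matpow A (Suc n) = A ** matpow A n"

definition monic_matpoly :: "nat \<Rightarrow> (complex \<Rightarrow> cmat2) \<Rightarrow> bool" where
  "monic_matpoly k P \<longleftrightarrow>
     (\<exists>C :: nat \<Rightarrow> cmat2. \<forall>z. P z = z ^ k *k mat 1 + (\<Sum>i<k. z ^ i *k C i))"

definition mat_contour_integral :: "(real \<Rightarrow> complex) \<Rightarrow> (complex \<Rightarrow> cmat2) \<Rightarrow> cmat2" where
  "mat_contour_integral \<gamma> F = (\<chi> i j. contour_integral \<gamma> (\<lambda>z. F z $ i $ j))"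

definition W :: "real \<Rightarrow> complex \<Rightarrow> cmat2" where
  "W \<alpha> z = mat2 (of_real \<alpha>) 1 z 1"

definition mvop :: "real \<Rightarrow> nat \<Rightarrow> nat \<Rightarrow> (real \<Rightarrow> complex) \<Rightarrow> nat \<Rightarrow> (complex \<Rightarrow> cmat2) \<Rightarrow> bool" where
  "mvop \<alpha> K L \<gamma> k P \<longleftrightarrow>
     monic_matpoly k P \<and>
     (\<forall>j<k. (1 / (2 * of_real pi * \<i>)) *k
        mat_contour_integral \<gamma> (\<lambda>z. (z ^ j / z ^ K) *k (P z ** matpow (W \<alpha> z) L)) = 0)"

definition monic_poly :: "nat \<Rightarrow> complex poly \<Rightarrow> bool" where
  "monic_poly n q \<longleftrightarrow> degree q = n \<and> lead_coeff q = 1"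

text \<open>The bound \<open>m\<close> is a parameter because \<open>q\<^sub>2\<^sub>k\<close> and \<open>q\<^sub>2\<^sub>k\<^sub>+\<^sub>1\<close> are both required to
  be orthogonal to the powers below \<open>m = 2k\<close>, independently of their own degrees.\<close>

definition scalar_orthogonal ::
  "real \<Rightarrow> real \<Rightarrow> nat \<Rightarrow> nat \<Rightarrow> real \<Rightarrow> nat \<Rightarrow> complex poly \<Rightarrow> bool" where
  "scalar_orthogonal \<alpha> \<beta> K L R m q \<longleftrightarrow>
     (\<forall>j<m. 1 / (2 * of_real pi * \<i>) *
        contour_integral (circlepath 0 R)
          (\<lambda>\<zeta>. poly q \<zeta> * \<zeta> ^ j *
               ((\<zeta> + of_real \<alpha> + of_real \<beta>) ^ L / (\<zeta>\<^sup>2 - (of_real \<beta>)\<^sup>2) ^ K)) = 0)"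

definition Emat :: "real \<Rightarrow> complex \<Rightarrow> cmat2" where
  "Emat \<beta> \<zeta> = mat2 1 1 (\<zeta> + of_real \<beta>) (- \<zeta> + of_real \<beta>)"

definition Qmat :: "complex poly \<Rightarrow> complex poly \<Rightarrow> complex \<Rightarrow> cmat2" where
  "Qmat q q' \<zeta> = mat2 (poly q \<zeta>) (poly q (- \<zeta>)) (poly q' \<zeta>) (poly q' (- \<zeta>))"

end

theory Submission
  imports Defs
begin

text \<open>Why the theorem holds. Since $1 - \beta = \alpha + \beta$, the vector $v(\zeta) = (1, \zeta + \beta)^T$
  is an eigenvector of $W_\alpha(\zeta^2 - \beta^2)$ with eigenvalue $\zeta + \alpha + \beta$
  (\<open>W_eigenvector\<close>). Multiplying a row $(p, r)$ of a matrix polynomial by $v(\zeta)$ gives the scalar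
  polynomial $p(\zeta^2 - \beta^2) + (\zeta + \beta)\, r(\zeta^2 - \beta^2)$, called \<open>row_poly\<close> below;
  multiplying the row by $W_\alpha^L$ first only multiplies this polynomial by
  $(\zeta + \alpha + \beta)^L$. Every polynomial of degree below $2k$ is the image of exactly one pair of
  polynomials of degree below $k$, so that rows of monic matrix polynomials and monic scalar polynomials
  carry the same information. The columns of \<open>Emat\<close> are $v(\zeta)$ and $v(-\zeta)$, which gives the
  matrix identity of part (a).

  The two kinds of orthogonality coincide because both are conditions on coefficients. If $f$ and $g$
  are the entries of a row of $P W_\alpha^L$, the matrix conditions say that the coefficients of $f$ and
  $g$ at $K-1, \ldots, K-k$ vanish (\<open>contour_integral_coeff_winding_1\<close>). On the circle, the part of
  an integrand that is even in $\zeta$ integrates to $0$, and the odd part is, after $z = \zeta^2 - \beta^2$,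
  an integral around $0$ in the variable $z$. Hence integrating \<open>row_poly\<close> $(p, r)$ against
  $(\zeta^2 - \beta^2)^{-K}$ returns the coefficient of $r$ at $K-1$ (\<open>node_functional_row_poly\<close>).
  Testing with $1$ and $\zeta + \beta$ times powers of $\zeta^2 - \beta^2$ then recovers exactly the
  coefficients above (\<open>scalar_orthogonal_row_poly_iff\<close>, \<open>mvop_iff_scalar_orthogonal\<close>).

  For the converse, a second row $(p, r)$ of a monic matrix polynomial yields a polynomial whose
  coefficient at $2k$ is $\beta$. The orthogonality conditions do not see the addition of a multiple of
  $q_{2k}$ to $q_{2k+1}$, and the number $c$ is the multiple that brings this coefficient to $\beta$. The
  matrix polynomial built from $q_{2k}$ and $q_{2k+1} + c\, q_{2k}$ satisfies the defining conditions of
  $P_k$, so it equals $P_k$ by uniqueness.\<close>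

section \<open>Polynomials as pairs of polynomials in the shifted square\<close>

definition shifted_square :: "complex \<Rightarrow> complex poly" where
  "shifted_square b = [:- (b\<^sup>2), 0, 1:]"

text \<open>The product of the row $(p, r)$, taken at $\zeta^2 - b^2$, with the eigenvector $(1, \zeta + b)^T$,
  as a polynomial in $\zeta$.\<close>

definition row_poly :: "complex \<Rightarrow> complex poly \<Rightarrow> complex poly \<Rightarrow> complex poly" where
  "row_poly b p r = pcompose p (shifted_square b) + [:b, 1:] * pcompose r (shifted_square b)"

text \<open>Stated with coefficients instead of \<open>degree f < n\<close> so that the zero polynomial has degree less
  than $0$, as the case $k = 0$ requires.\<close>

definition degree_less :: "nat \<Rightarrow> complex poly \<Rightarrow> bool" where
  "degree_less n f \<longleftrightarrow> (\<forall>i\<ge>n. coeff f i = 0)"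

lemma poly_shifted_square: "poly (shifted_square b) x = x\<^sup>2 - b\<^sup>2"
  by (simp add: shifted_square_def power2_eq_square algebra_simps)

lemma poly_row_poly: "poly (row_poly b p r) x = poly p (x\<^sup>2 - b\<^sup>2) + (x + b) * poly r (x\<^sup>2 - b\<^sup>2)"
  by (simp add: row_poly_def poly_pcompose poly_shifted_square algebra_simps)

lemma poly_eqI_values: "(\<And>x::complex. poly p x = poly q x) \<Longrightarrow> p = q"
  using poly_eq_poly_eq_iff by blast

lemma row_poly_add: "row_poly b p r + row_poly b p' r' = row_poly b (p + p') (r + r')"
  by (rule poly_eqI_values) (simp add: poly_row_poly algebra_simps)

text \<open>Multiplication modulo the relation $(\zeta + b)^2 = (\zeta^2 - b^2) + 2b(\zeta + b)$.\<close>

lemma row_poly_mult: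
  "row_poly b p r * row_poly b s t
     = row_poly b (p * s + [:0, 1:] * (r * t)) (p * t + r * s + [:2 * b:] * (r * t))"
  by (rule poly_eqI_values) (simp add: poly_row_poly algebra_simps power2_eq_square)

lemma degree_less_monom: "m < n \<Longrightarrow> degree_less n (monom c m)"
  by (simp add: degree_less_def)

lemma degree_less_imp_eq_sum: "degree_less n f \<Longrightarrow> f = (\<Sum>i<n. monom (coeff f i) i)"
  by (intro poly_eqI) (auto simp: degree_less_def coeff_sum if_distrib cong: if_cong)

lemma degree_less_row_poly:
  assumes "degree_less k p" "degree_less k r"
  shows "degree_less (2 * k) (row_poly b p r)"
proof (cases k)
  case 0
  then have "p = 0" "r = 0"
    using assms by (auto simp: degree_less_def poly_eq_iff)
  then show ?thesis
    by (simp add: row_poly_def degree_less_def)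
next
  case (Suc m)
  have deg: "degree f \<le> m" if "degree_less k f" for f
    using that Suc by (intro degree_le) (auto simp: degree_less_def)
  have comp: "degree (pcompose f (shifted_square b)) \<le> 2 * m" if "degree_less k f" for f
    using deg[OF that] by (simp add: shifted_square_def degree_pcompose mult.commute)
  have "degree (pcompose p (shifted_square b)) \<le> 2 * m + 1"
    using comp[OF assms(1)] by simp
  moreover have "degree ([:b, 1:] * pcompose r (shifted_square b))
      \<le> 1 + degree (pcompose r (shifted_square b))"
    using degree_mult_le[of "[:b, 1:]"] by simp
  then have "degree ([:b, 1:] * pcompose r (shifted_square b)) \<le> 2 * m + 1"
    using comp[OF assms(2)] by linarith
  ultimately have "degree (row_poly b p r) \<le> 2 * m + 1"
    unfolding row_poly_def by (rule degree_add_le)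
  then show ?thesis
    using Suc by (auto simp: degree_less_def intro: coeff_eq_0)
qed

text \<open>Splitting off the two lowest coefficients leaves a factor $\zeta^2 = (\zeta^2 - b^2) + b^2$, which
  acts on both components of the shorter polynomial as multiplication by $z + b^2$.\<close>

lemma degree_less_row_poly_exists:
  assumes "degree_less (2 * k) f"
  shows "\<exists>p r. degree_less k p \<and> degree_less k r \<and> f = row_poly b p r"
  using assms
proof (induction k arbitrary: f)
  case 0
  then have "f = 0"
    by (simp add: degree_less_def poly_eq_iff)
  then show ?case
    by (intro exI[of _ 0]) (simp add: degree_less_def row_poly_def)
next
  case (Suc k)
  obtain c d g where f: "f = pCons c (pCons d g)"
    by (metis pCons_cases)
  have "degree_less (2 * k) g"
    unfolding degree_less_def
  proof (intro allI impI)
    fix i assume "2 * k \<le> i"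
    then have "coeff f (Suc (Suc i)) = 0"
      using Suc.prems by (simp add: degree_less_def)
    then show "coeff g i = 0"
      by (simp add: f)
  qed
  then obtain p r where pr: "degree_less k p" "degree_less k r" "g = row_poly b p r"
    using Suc.IH by blast
  let ?p = "[:b\<^sup>2, 1:] * p + [:c - d * b:]" and ?r = "[:b\<^sup>2, 1:] * r + [:d:]"
  have "f = row_poly b ?p ?r"
    by (rule poly_eqI_values) (simp add: f pr poly_row_poly algebra_simps power2_eq_square)
  moreover have "degree_less (Suc k) ?p" "degree_less (Suc k) ?r"
    using pr by (auto simp: degree_less_def coeff_pCons split: nat.split)
  ultimately show ?case
    by blast
qed

lemma shifted_square_power_coeffs:
  "coeff (shifted_square b ^ k) (2 * k) = 1 \<and> degree_less (2 * k + 1) (shifted_square b ^ k)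
   \<and> (\<forall>i. odd i \<longrightarrow> coeff (shifted_square b ^ k) i = 0)"
proof (induction k)
  case 0
  show ?case
    by (auto simp: degree_less_def intro: odd_pos)
next
  case (Suc k)
  have "shifted_square b ^ Suc k
      = pCons 0 (pCons 0 (shifted_square b ^ k)) - smult (b\<^sup>2) (shifted_square b ^ k)"
    by (rule poly_eqI_values) (simp add: poly_shifted_square algebra_simps power2_eq_square)
  then show ?case
    using Suc by (auto simp: degree_less_def coeff_pCons split: nat.split)
qed

lemma monic_poly_iff_coeffs:
  "monic_poly n q \<longleftrightarrow> coeff q n = 1 \<and> degree_less (Suc n) q"
proof
  assume "monic_poly n q"
  then show "coeff q n = 1 \<and> degree_less (Suc n) q"
    by (auto simp: monic_poly_def degree_less_def intro: coeff_eq_0)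
next
  assume *: "coeff q n = 1 \<and> degree_less (Suc n) q"
  then have "degree q = n"
    by (intro antisym degree_le le_degree) (auto simp: degree_less_def)
  with * show "monic_poly n q"
    by (simp add: monic_poly_def)
qed

lemma row_poly_monom_0: "row_poly b (monom 1 k) 0 = shifted_square b ^ k"
  by (rule poly_eqI_values) (simp add: poly_row_poly poly_shifted_square poly_monom)

lemma row_poly_0_monom: "row_poly b 0 (monom 1 k) = [:b, 1:] * shifted_square b ^ k"
  by (rule poly_eqI_values)
     (simp add: poly_row_poly poly_shifted_square poly_monom algebra_simps)

lemma monic_poly_even_iff:
  "monic_poly (2 * k) q \<longleftrightarrow> degree_less (2 * k) (q - row_poly b (monom 1 k) 0)"
proof -
  have split: "(\<forall>i\<ge>n. Q i) \<longleftrightarrow> Q n \<and> (\<forall>i\<ge>Suc n. Q i)" for Q and n :: nat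
    by (metis Suc_leD Suc_leI le_neq_implies_less order_refl)
  show ?thesis
    using shifted_square_power_coeffs[of b k]
    unfolding monic_poly_iff_coeffs row_poly_monom_0 degree_less_def split[of "2 * k"] by simp
qed

text \<open>The pair $(0, z^k)$ corresponds to $(\zeta + b)(\zeta^2 - b^2)^k$, whose two leading coefficients are
  $1$ and $b$. A second row $(p, r)$ differs from it in degrees below $2k$ only, which is why the
  coefficient at $2k$ is prescribed and $q_{2k+1}$ needs a correction by a multiple of $q_{2k}$.\<close>

lemma monic_poly_odd_iff:
  "monic_poly (2 * k + 1) q \<and> coeff q (2 * k) = b
     \<longleftrightarrow> degree_less (2 * k) (q - row_poly b 0 (monom 1 k))"
proof -
  define g where "g = [:b, 1:] * shifted_square b ^ k"
  have g: "coeff g (2 * k) = b" "coeff g (2 * k + 1) = 1" "\<And>i. 2 * k + 1 < i \<Longrightarrow> coeff g i = 0"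
    using shifted_square_power_coeffs[of b k]
    by (auto simp: g_def degree_less_def coeff_pCons split: nat.split) (metis even_Suc even_mult_iff even_numeral)
  have split: "(\<forall>i\<ge>2 * k. P i) \<longleftrightarrow> P (2 * k) \<and> P (2 * k + 1) \<and> (\<forall>i>2 * k + 1. P i)" for P
  proof -
    have "2 * k \<le> i \<longleftrightarrow> i = 2 * k \<or> i = 2 * k + 1 \<or> 2 * k + 1 < i" for i
      by linarith
    then show ?thesis
      by auto
  qed
  have "degree_less (2 * k) (q - g)
      \<longleftrightarrow> coeff q (2 * k) = b \<and> coeff q (2 * k + 1) = 1 \<and> (\<forall>i>2 * k + 1. coeff q i = 0)"
    unfolding degree_less_def split using g by simp
  then show ?thesis
    unfolding monic_poly_iff_coeffs row_poly_0_monom g_def[symmetric] degree_less_def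
    by (auto simp: Suc_le_eq)
qed

section \<open>Contour integrals that read off a coefficient\<close>

text \<open>Substitution $w = h(z)$ in the coefficient formula, without passing to the image curve: the
  integrand is a combination of $h' h^m$ with $m \ne -1$, which have the primitives $h^{m+1}/(m+1)$, and of
  one multiple of $h'/h$. It is used with $h(z) = z$ on the given curve and with $h(\zeta) = \zeta^2 - \beta^2$
  on the circle.\<close>

lemma has_contour_integral_coeff:
  fixes h h' :: "complex \<Rightarrow> complex"
  assumes path: "valid_path g" "pathfinish g = pathstart g"
    and nz: "\<And>z. z \<in> path_image g \<Longrightarrow> h z \<noteq> 0"
    and deriv: "\<And>z. (h has_field_derivative h' z) (at z)"
    and log: "((\<lambda>z. h' z / h z) has_contour_integral I) g"
  shows "((\<lambda>z. h' z * poly p (h z) / h z ^ Suc n) has_contour_integral coeff p n * I) g"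
proof -
  define m where "m i = int i - int n" for i
  have single: "((\<lambda>z. coeff p i * (h' z * (h z powi (m i - 1)))) has_contour_integral
                  (if i = n then coeff p n * I else 0)) g" for i
  proof (cases "i = n")
    case True
    then show ?thesis
      using has_contour_integral_lmul[OF log, of "coeff p n"]
      by (simp add: m_def power_int_minus divide_simps field_simps)
  next
    case False
    have "((\<lambda>z. h z powi m i / of_int (m i)) has_field_derivative
            h' z * (h z powi (m i - 1))) (at z within path_image g)"
      if "z \<in> path_image g" for z
      using False nz[OF that]
      by (auto intro!: derivative_eq_intros DERIV_subset[OF deriv] simp: m_def)
    then have "((\<lambda>z. h' z * (h z powi (m i - 1))) has_contour_integral 0) g"
      by (rule Cauchy_theorem_primitive) (use path in auto)
    from has_contour_integral_lmul[OF this, of "coeff p i"] show ?thesis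
      using False by simp
  qed
  have "((\<lambda>z. \<Sum>i\<le>max n (degree p). coeff p i * (h' z * (h z powi (m i - 1))))
      has_contour_integral (\<Sum>i\<le>max n (degree p). if i = n then coeff p n * I else 0)) g"
    by (intro has_contour_integral_sum single) simp
  also have "(\<Sum>i\<le>max n (degree p). if i = n then coeff p n * I else 0) = coeff p n * I"
    by simp
  finally show ?thesis
  proof (rule has_contour_integral_eq)
    fix z assume "z \<in> path_image g"
    then have "h z \<noteq> 0"
      by (rule nz)
    then have "h z powi (m i - 1) = h z ^ i / h z ^ Suc n" for i
      by (simp add: m_def power_int_diff diff_diff_eq power_int_add)
    moreover have "poly p (h z) = (\<Sum>i\<le>max n (degree p). coeff p i * h z ^ i)"
      unfolding poly_altdef by (rule sum.mono_neutral_left) (auto simp: coeff_eq_0)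
    ultimately show "(\<Sum>i\<le>max n (degree p). coeff p i * (h' z * (h z powi (m i - 1))))
        = h' z * poly p (h z) / h z ^ Suc n"
      by (simp add: sum_distrib_left sum_divide_distrib mult_ac)
  qed
qed

lemma contour_integral_coeff_winding_1:
  assumes "valid_path g" "pathfinish g = pathstart g" "0 \<notin> path_image g" "winding_number g 0 = 1"
  shows "1 / (2 * of_real pi * \<i>) * contour_integral g (\<lambda>z. poly p z / z ^ Suc n) = coeff p n"
proof -
  have "((\<lambda>z. 1 / z) has_contour_integral 2 * pi * \<i>) g"
    using has_contour_integral_winding_number[of g 0] assms by simp
  then have "((\<lambda>z. 1 * poly p z / z ^ Suc n) has_contour_integral coeff p n * (2 * pi * \<i>)) g"
    using assms by (intro has_contour_integral_coeff) auto
  then show ?thesis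
    by (simp add: contour_integral_unique)
qed

text \<open>Negation rotates the circle by a half turn, so it preserves the integral of every function, while the
  substitution $z \mapsto -z$ changes the sign of $dz$.\<close>

lemma contour_integral_circlepath_even:
  assumes "\<And>z. f (- z) = f z"
  shows "contour_integral (circlepath 0 R) f = 0"
proof -
  have "shiftpath (1 / 2) (circlepath 0 R) = uminus \<circ> circlepath 0 R"
  proof
    fix x :: real
    have "circlepath 0 R (1 / 2 + x) = - circlepath 0 R x"
      using circlepath_minus[of 0 R x] by (simp add: add.commute circlepath)
    moreover have "circlepath 0 R (1 / 2 + x - 1) = circlepath 0 R (1 / 2 + x)"
      using circlepath_add1[of 0 R "1 / 2 + x - 1"] by simp
    ultimately show "shiftpath (1 / 2) (circlepath 0 R) x = (uminus \<circ> circlepath 0 R) x"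
      by (simp add: shiftpath_def)
  qed
  then have "contour_integral (circlepath 0 R) f = contour_integral (uminus \<circ> circlepath 0 R) f"
    using contour_integral_shiftpath[of "circlepath 0 R" "1 / 2" f] by simp
  also have "\<dots> = - contour_integral (circlepath 0 R) f"
    by (subst contour_integral_negatepath) (simp_all add: assms)
  finally show ?thesis
    by simp
qed

section \<open>The scalar functional\<close>

text \<open>The weight of the scalar orthogonality without its numerator $(\zeta + \alpha + \beta)^L$, which is
  absorbed into the polynomial argument.\<close>

definition node_functional :: "complex \<Rightarrow> nat \<Rightarrow> real \<Rightarrow> complex poly \<Rightarrow> complex" where
  "node_functional b K R f =
     1 / (2 * of_real pi * \<i>) * contour_integral (circlepath 0 R) (\<lambda>x. poly f x / (x\<^sup>2 - b\<^sup>2) ^ K)"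

lemma shifted_square_nonzero_on_circle:
  assumes "x \<in> path_image (circlepath 0 R)" "norm b < R"
  shows "x\<^sup>2 - b\<^sup>2 \<noteq> 0"
proof -
  have "norm x = R"
    using assms norm_ge_zero[of b] by (simp add: less_eq_real_def)
  then show ?thesis
    using assms(2) by (auto simp: power2_eq_iff)
qed

lemma node_integrable:
  assumes "norm b < R"
  shows "(\<lambda>x. poly f x / (x\<^sup>2 - b\<^sup>2) ^ K) contour_integrable_on circlepath 0 R"
  by (intro contour_integrable_continuous_circlepath continuous_intros)
     (use shifted_square_nonzero_on_circle[OF _ assms] in auto)

lemma node_functional_add:
  assumes "norm b < R"
  shows "node_functional b K R (f + g) = node_functional b K R f + node_functional b K R g"
  using contour_integral_add[OF node_integrable[OF assms] node_integrable[OF assms], of f K g K]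
  by (simp add: node_functional_def add_divide_distrib distrib_left)

lemma node_functional_smult:
  assumes "norm b < R"
  shows "node_functional b K R (smult c f) = c * node_functional b K R f"
  using contour_integral_lmul[OF node_integrable[OF assms], of c f K]
  by (simp add: node_functional_def)

lemma node_functional_sum:
  assumes "norm b < R"
  shows "node_functional b K R (\<Sum>i\<in>A. f i) = (\<Sum>i\<in>A. node_functional b K R (f i))"
proof (induction A rule: infinite_finite_induct)
  case (insert x F)
  then show ?case
    by (simp add: node_functional_add[OF assms])
qed (simp_all add: node_functional_def)

text \<open>Only the odd part $\zeta\, r(\zeta^2 - b^2)$ of the polynomial contributes. The coefficient formula for
  $h(\zeta) = \zeta^2 - b^2$ applies to it: $h'/h = 1/(\zeta - b) + 1/(\zeta + b)$ integrates to
  $2 \cdot 2\pi i$ because $b$ and $-b$ lie inside the circle, and this factor $2$ cancels against $h'(\zeta) = 2\zeta$.\<close>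

lemma node_functional_row_poly:
  assumes R: "norm b < R"
  shows "node_functional b (Suc n) R (row_poly b p r) = coeff r n"
proof -
  let ?D = "\<lambda>x. (x\<^sup>2 - b\<^sup>2 :: complex)" and ?g = "circlepath 0 R"
  have pole: "((\<lambda>x. 1 / (x - a)) has_contour_integral 2 * pi * \<i>) ?g" if "norm a = norm b" for a
    using has_contour_integral_winding_number[of ?g a] winding_number_circlepath[of a 0 R] R that
    by simp
  have "((\<lambda>x. 1 / (x - b) + 1 / (x - (- b))) has_contour_integral (2 * pi * \<i> + 2 * pi * \<i>)) ?g"
    by (intro has_contour_integral_add pole) auto
  then have "((\<lambda>x. 2 * x / ?D x) has_contour_integral (2 * pi * \<i> + 2 * pi * \<i>)) ?g"
  proof (rule has_contour_integral_eq)
    fix x assume "x \<in> path_image ?g"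
    then have "?D x \<noteq> 0"
      by (rule shifted_square_nonzero_on_circle[OF _ R])
    moreover have "?D x = (x - b) * (x + b)"
      by (simp add: algebra_simps power2_eq_square)
    ultimately show "1 / (x - b) + 1 / (x - (- b)) = 2 * x / ?D x"
      by (simp add: add_frac_eq)
  qed
  then have "((\<lambda>x. 2 * x * poly r (?D x) / ?D x ^ Suc n) has_contour_integral
               coeff r n * (2 * pi * \<i> + 2 * pi * \<i>)) ?g"
    by (intro has_contour_integral_coeff shifted_square_nonzero_on_circle[OF _ R])
       (auto intro!: derivative_eq_intros)
  from has_contour_integral_lmul[OF this, of "1 / 2"]
  have odd: "((\<lambda>x. x * poly r (?D x) / ?D x ^ Suc n) has_contour_integral
               coeff r n * (2 * pi * \<i>)) ?g"
    by (simp add: field_simps)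
  define e where "e x = (poly p (?D x) + b * poly r (?D x)) / ?D x ^ Suc n" for x
  have "e contour_integrable_on ?g"
    using node_integrable[OF R, of "pcompose p (shifted_square b)
        + smult b (pcompose r (shifted_square b))" "Suc n"]
    unfolding e_def by (simp add: poly_pcompose poly_shifted_square)
  moreover have "contour_integral ?g e = 0"
    by (rule contour_integral_circlepath_even) (simp add: e_def)
  ultimately have "(e has_contour_integral 0) ?g"
    by (metis has_contour_integral_integral)
  from has_contour_integral_add[OF odd this]
  have "((\<lambda>x. poly (row_poly b p r) x / ?D x ^ Suc n) has_contour_integral
          coeff r n * (2 * pi * \<i>)) ?g"
    by (simp add: e_def poly_row_poly add_divide_distrib[symmetric] algebra_simps)
  then show ?thesis
    unfolding node_functional_def by (simp add: contour_integral_unique)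
qed

text \<open>By linearity the monomials $\zeta^j$ may be replaced by all test polynomials of degree below $m$, in
  particular by those adapted to the decomposition by \<open>row_poly\<close>.\<close>

lemma scalar_orthogonal_iff:
  "scalar_orthogonal \<alpha> \<beta> K L R m q \<longleftrightarrow>
     (\<forall>s. degree_less m s \<longrightarrow>
        node_functional (of_real \<beta>) K R (q * [:of_real (\<alpha> + \<beta>), 1:] ^ L * s) = 0)"
  if R: "\<bar>\<beta>\<bar> < R"
proof -
  let ?F = "node_functional (of_real \<beta>) K R" and ?w = "q * [:of_real (\<alpha> + \<beta>), 1:] ^ L"
  have R': "norm (of_real \<beta> :: complex) < R"
    using R by simp
  have *: "scalar_orthogonal \<alpha> \<beta> K L R m q \<longleftrightarrow> (\<forall>j<m. ?F (?w * monom 1 j) = 0)"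
    unfolding scalar_orthogonal_def node_functional_def
    by (simp add: poly_monom mult_ac add_ac)
  have "?F (?w * s) = 0" if "\<forall>j<m. ?F (?w * monom 1 j) = 0" "degree_less m s" for s
  proof -
    have "?w * s = (\<Sum>i<m. smult (coeff s i) (?w * monom 1 i))"
      using arg_cong[OF degree_less_imp_eq_sum[OF that(2)], of "(*) ?w"]
      by (simp add: sum_distrib_left smult_monom flip: mult_smult_right)
    then show ?thesis
      using that(1) by (simp add: node_functional_sum[OF R'] node_functional_smult[OF R'])
  qed
  then show ?thesis
    unfolding * using degree_less_monom by blast
qed

lemma coeff_mult_eq_0:
  assumes "degree_less k g" "\<And>j. j < k \<Longrightarrow> coeff f (n - j) = 0" "k \<le> Suc n"
  shows "coeff (f * g) n = (0::complex)"
proof -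
  have "coeff (g * f) n = (\<Sum>i\<le>n. coeff g i * coeff f (n - i))"
    by (rule coeff_mult)
  also have "\<dots> = 0"
    using assms by (intro sum.neutral) (metis degree_less_def mult_eq_0_iff not_le)
  finally show ?thesis
    by (simp add: mult.commute)
qed

text \<open>With a test polynomial \<open>row_poly\<close> $(s, t)$ the functional returns the coefficient of
  $f t + g s + 2\beta g t$ at $K - 1$. The choice $s = z^j$, $t = 0$ isolates the coefficient of $g$ at
  $K - 1 - j$. Once these vanish, $s = 0$, $t = z^j$ isolates that of $f$. Conversely only these
  coefficients of $f$ and $g$ can meet a factor of degree below $k$.\<close>

lemma scalar_orthogonal_row_poly_iff:
  assumes R: "\<bar>\<beta>\<bar> < R" and "k \<le> K"
    and eq: "q * [:of_real (\<alpha> + \<beta>), 1:] ^ L = row_poly (of_real \<beta>) f g"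
  shows "scalar_orthogonal \<alpha> \<beta> K L R (2 * k) q
     \<longleftrightarrow> (\<forall>j<k. coeff f (K - Suc j) = 0 \<and> coeff g (K - Suc j) = 0)"
proof (cases K)
  case 0
  then show ?thesis
    using \<open>k \<le> K\<close> by (simp add: scalar_orthogonal_def)
next
  case (Suc n)
  let ?b = "of_real \<beta> :: complex" and ?F = "node_functional (of_real \<beta>) K R"
  have value_row_poly: "?F (row_poly ?b f g * row_poly ?b s t) = coeff (f * t + g * s + [:2 * ?b:] * (g * t)) n"
    for s t
    using node_functional_row_poly[of ?b R n] R Suc by (simp add: row_poly_mult)
  show ?thesis
    unfolding scalar_orthogonal_iff[OF R] eq
  proof safe
    fix j assume orth: "\<forall>s. degree_less (2 * k) s \<longrightarrow> ?F (row_poly ?b f g * s) = 0" and "j < k"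
    have shift: "coeff (h * monom 1 j) n = coeff h (n - j)" for h :: "complex poly"
      using \<open>j < k\<close> \<open>k \<le> K\<close> Suc by (simp add: coeff_monom_mult mult.commute[of h])
    have dl: "degree_less k (monom 1 j)" "degree_less k 0"
      using \<open>j < k\<close> by (simp_all add: degree_less_monom degree_less_def)
    have 1: "coeff g (n - j) = 0"
      using orth[rule_format, OF degree_less_row_poly[OF dl(1,2), of ?b]] by (simp add: value_row_poly shift)
    have 2: "coeff f (n - j) = 0"
      using orth[rule_format, OF degree_less_row_poly[OF dl(2,1), of ?b]] 1 by (simp add: value_row_poly shift)
    show "coeff g (K - Suc j) = 0" "coeff f (K - Suc j) = 0"
      using 1 2 Suc by simp_all
  next
    fix s assume coeffs: "\<forall>j<k. coeff f (K - Suc j) = 0 \<and> coeff g (K - Suc j) = 0"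
      and "degree_less (2 * k) s"
    then obtain u v where uv: "degree_less k u" "degree_less k v" "s = row_poly ?b u v"
      using degree_less_row_poly_exists by blast
    have "coeff (f * v) n = 0" "coeff (g * u) n = 0" "coeff (g * v) n = 0"
      using coeffs uv \<open>k \<le> K\<close> Suc by (auto intro!: coeff_mult_eq_0[of k])
    then show "?F (row_poly ?b f g * s) = 0"
      by (simp add: uv(3) value_row_poly)
  qed
qed

section \<open>Matrix polynomials with orthogonality, row by row\<close>

text \<open>Matrix polynomials are functions in the orthogonality condition, whereas degrees and coefficients
  belong to polynomials; this predicate connects the two.\<close>

definition matpoly_entries :: "(complex \<Rightarrow> cmat2) \<Rightarrow> (2 \<Rightarrow> 2 \<Rightarrow> complex poly) \<Rightarrow> bool" where
  "matpoly_entries A a \<longleftrightarrow> (\<forall>z i j. A z $ i $ j = poly (a i j) z)"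

lemma mat_scale_component [simp]: "(c *k A) $ i $ j = c * A $ i $ j"
  by (simp add: mat_scale_def)

lemma matpoly_entries_mult:
  assumes "matpoly_entries A a" "matpoly_entries B b"
  shows "matpoly_entries (\<lambda>z. A z ** B z) (\<lambda>i j. \<Sum>l\<in>UNIV. a i l * b l j)"
  using assms by (simp add: matpoly_entries_def matrix_matrix_mult_def poly_sum)

lemma monic_matpoly_iff:
  "monic_matpoly k P \<longleftrightarrow> (\<exists>p. matpoly_entries P p \<and>
     (\<forall>i j. degree_less k (p i j - (if i = j then monom 1 k else 0))))"
proof
  assume "monic_matpoly k P"
  then obtain C where C: "\<And>z. P z = z ^ k *k mat 1 + (\<Sum>i<k. z ^ i *k C i)"
    by (auto simp: monic_matpoly_def)
  define p where
    "p i j = (if i = j then monom 1 k else 0) + (\<Sum>l<k. monom (C l $ i $ j) l)" for i j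
  have "matpoly_entries P p"
    by (auto simp: matpoly_entries_def C p_def poly_sum poly_monom mat_def sum_component mult_ac)
  moreover have "degree_less k (p i j - (if i = j then monom 1 k else 0))" for i j
    by (auto simp: p_def degree_less_def coeff_sum)
  ultimately show "\<exists>p. matpoly_entries P p \<and>
     (\<forall>i j. degree_less k (p i j - (if i = j then monom 1 k else 0)))"
    by blast
next
  assume "\<exists>p. matpoly_entries P p \<and>
     (\<forall>i j. degree_less k (p i j - (if i = j then monom 1 k else 0)))"
  then obtain p where p: "matpoly_entries P p"
    "\<And>i j. degree_less k (p i j - (if i = j then monom 1 k else 0))"
    by blast
  define C :: "nat \<Rightarrow> cmat2" where
    "C l = (\<chi> i j. coeff (p i j - (if i = j then monom 1 k else 0)) l)" for l
  have "P z $ i $ j = (z ^ k *k mat 1 + (\<Sum>i<k. z ^ i *k C i)) $ i $ j" for z i j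
  proof -
    have "P z $ i $ j = poly ((if i = j then monom 1 k else 0)
            + (p i j - (if i = j then monom 1 k else 0))) z"
      using p(1) by (simp add: matpoly_entries_def)
    also have "\<dots> = poly (if i = j then monom 1 k else 0) z + (\<Sum>l<k. z ^ l * C l $ i $ j)"
      by (subst degree_less_imp_eq_sum[OF p(2)[of i j]])
         (simp only: C_def poly_add poly_sum poly_monom vec_lambda_beta mult.commute)
    finally show ?thesis
      by (simp add: sum_component mat_def poly_monom)
  qed
  then show "monic_matpoly k P"
    unfolding monic_matpoly_def by (intro exI[of _ C] allI) (simp add: vec_eq_iff)
qed

lemma matpow_W_entries: "\<exists>w. matpoly_entries (\<lambda>z. matpow (W \<alpha> z) L) w"
proof (induction L)
  case 0
  have "matpoly_entries (\<lambda>z. matpow (W \<alpha> z) 0) (\<lambda>i j. if i = j then 1 else 0)"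
    by (simp add: matpoly_entries_def mat_def)
  then show ?case
    by blast
next
  case (Suc L)
  have "matpoly_entries (W \<alpha>)
      (\<lambda>i j. if j = 2 then 1 else if i = 1 then [:of_real \<alpha>:] else [:0, 1:])"
    by (simp add: matpoly_entries_def W_def forall_2 vector_2)
  then show ?case
    using Suc matpoly_entries_mult by fastforce
qed

text \<open>The second component reads $(\zeta - \beta + 1)(\zeta + \beta) = (\zeta + \alpha + \beta)(\zeta + \beta)$,
  which is the choice of $\beta$.\<close>

lemma W_eigenvector:
  assumes "\<beta> = (1 - \<alpha>) / 2"
  shows "W \<alpha> (\<zeta>\<^sup>2 - (of_real \<beta>)\<^sup>2) *v vector [1, \<zeta> + of_real \<beta>]
       = (\<zeta> + of_real (\<alpha> + \<beta>)) *s vector [1, \<zeta> + of_real \<beta>]"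
proof -
  have \<alpha>: "\<alpha> = 1 - 2 * \<beta>"
    using assms by (simp add: field_simps)
  show ?thesis
    unfolding \<alpha> by (simp add: vec_eq_iff forall_2 W_def matrix_vector_mult_def sum_2 vector_2
        algebra_simps power2_eq_square)
qed

lemma matpow_eigenvector:
  assumes "A *v v = c *s v"
  shows "matpow A n *v v = c ^ n *s v"
proof (induction n)
  case (Suc n)
  then show ?case
    by (simp add: matrix_vector_mul_assoc[symmetric] vector_scalar_commute assms
        vector_smult_assoc mult.commute)
qed simp

text \<open>Associativity, $(P W_\alpha^L) v = P (W_\alpha^L v)$, for the eigenvector $v = v(\zeta)$.\<close>

lemma row_poly_matpow_W:
  assumes \<beta>: "\<beta> = (1 - \<alpha>) / 2" and p: "matpoly_entries P p"
    and r: "matpoly_entries (\<lambda>z. P z ** matpow (W \<alpha> z) L) r"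
  shows "row_poly (of_real \<beta>) (p i 1) (p i 2) * [:of_real (\<alpha> + \<beta>), 1:] ^ L
       = row_poly (of_real \<beta>) (r i 1) (r i 2)"
proof (rule poly_eqI_values)
  fix \<zeta> :: complex
  let ?z = "\<zeta>\<^sup>2 - (of_real \<beta>)\<^sup>2" and ?v = "vector [1, \<zeta> + of_real \<beta>] :: complex^2"
  have row: "(A ?z *v ?v) $ i = poly (row_poly (of_real \<beta>) (a i 1) (a i 2)) \<zeta>"
    if "matpoly_entries A a" for A a
    using that
    by (simp add: matpoly_entries_def poly_row_poly matrix_vector_mult_def sum_2 vector_2 mult.commute)
  have "(P ?z ** matpow (W \<alpha> ?z) L) *v ?v = (\<zeta> + of_real (\<alpha> + \<beta>)) ^ L *s (P ?z *v ?v)"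
    unfolding matrix_vector_mul_assoc[symmetric] matpow_eigenvector[OF W_eigenvector[OF \<beta>]]
    by (simp add: vector_scalar_commute)
  then have "((P ?z ** matpow (W \<alpha> ?z) L) *v ?v) $ i
      = (\<zeta> + of_real (\<alpha> + \<beta>)) ^ L * (P ?z *v ?v) $ i"
    by simp
  then show "poly (row_poly (of_real \<beta>) (p i 1) (p i 2) * [:of_real (\<alpha> + \<beta>), 1:] ^ L) \<zeta>
      = poly (row_poly (of_real \<beta>) (r i 1) (r i 2)) \<zeta>"
    unfolding row[OF p] row[OF r] by (simp add: mult.commute add.commute)
qed

text \<open>Both sides say that the entries of $P W_\alpha^L$ have vanishing coefficients at $K - 1 - j$ for all
  $j < k$.\<close>

lemma mvop_iff_scalar_orthogonal:
  assumes "k \<le> K" and \<beta>: "\<beta> = (1 - \<alpha>) / 2" and R: "\<bar>\<beta>\<bar> < R"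
    and \<gamma>: "valid_path \<gamma>" "pathfinish \<gamma> = pathstart \<gamma>" "0 \<notin> path_image \<gamma>" "winding_number \<gamma> 0 = 1"
    and p: "matpoly_entries P p"
  shows "mvop \<alpha> K L \<gamma> k P \<longleftrightarrow> monic_matpoly k P \<and>
    (\<forall>i. scalar_orthogonal \<alpha> \<beta> K L R (2 * k) (row_poly (of_real \<beta>) (p i 1) (p i 2)))"
proof -
  obtain r where r: "matpoly_entries (\<lambda>z. P z ** matpow (W \<alpha> z) L) r"
    using matpow_W_entries matpoly_entries_mult[OF p] by blast
  have integral: "1 / (2 * of_real pi * \<i>) * contour_integral \<gamma>
      (\<lambda>z. z ^ j / z ^ K * (P z ** matpow (W \<alpha> z) L) $ i $ l) = coeff (r i l) (K - Suc j)"
    if "j < k" for i j l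
  proof -
    have "contour_integral \<gamma> (\<lambda>z. z ^ j / z ^ K * (P z ** matpow (W \<alpha> z) L) $ i $ l)
        = contour_integral \<gamma> (\<lambda>z. poly (r i l) z / z ^ Suc (K - Suc j))"
    proof (rule contour_integral_cong)
      fix z assume "z \<in> path_image \<gamma>"
      then have "z \<noteq> 0"
        using \<gamma>(3) by auto
      moreover have "K = j + Suc (K - Suc j)"
        using that \<open>k \<le> K\<close> by simp
      then have "z ^ K = z ^ j * z ^ Suc (K - Suc j)"
        by (metis power_add)
      ultimately show "z ^ j / z ^ K * (P z ** matpow (W \<alpha> z) L) $ i $ l
          = poly (r i l) z / z ^ Suc (K - Suc j)"
        using r by (simp add: matpoly_entries_def)
    qed simp
    then show ?thesis
      using contour_integral_coeff_winding_1[OF \<gamma>] by simp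
  qed
  have "mvop \<alpha> K L \<gamma> k P \<longleftrightarrow> monic_matpoly k P \<and>
      (\<forall>j<k. \<forall>i l. coeff (r i l) (K - Suc j) = 0)"
    unfolding mvop_def
    by (intro conj_cong refl all_cong)
       (simp add: vec_eq_iff mat_contour_integral_def integral[symmetric])
  also have "\<dots> \<longleftrightarrow> monic_matpoly k P \<and>
      (\<forall>i. scalar_orthogonal \<alpha> \<beta> K L R (2 * k) (row_poly (of_real \<beta>) (p i 1) (p i 2)))"
    unfolding scalar_orthogonal_row_poly_iff[OF R \<open>k \<le> K\<close> row_poly_matpow_W[OF \<beta> p r]]
    by (auto simp: forall_2)
  finally show ?thesis .
qed

section \<open>The matrix of scalar polynomials\<close>

lemma matpoly_times_Emat:
  assumes "matpoly_entries P p"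
  shows "P (\<zeta>\<^sup>2 - (of_real \<beta>)\<^sup>2) ** Emat \<beta> \<zeta>
       = Qmat (row_poly (of_real \<beta>) (p 1 1) (p 1 2)) (row_poly (of_real \<beta>) (p 2 1) (p 2 2)) \<zeta>"
  using assms
  by (simp add: vec_eq_iff forall_2 matpoly_entries_def Emat_def Qmat_def matrix_matrix_mult_def
      sum_2 vector_2 poly_row_poly algebra_simps)

lemma invertible_Emat: "\<zeta> \<noteq> 0 \<Longrightarrow> invertible (Emat \<beta> \<zeta>)"
  by (simp add: invertible_det_nz det_2 Emat_def vector_2)

lemma matrix_inv_right:
  fixes A :: "'a::semiring_1^'n^'n"
  assumes "invertible A"
  shows "A ** matrix_inv A = mat 1"
  using someI_ex[OF assms[unfolded invertible_def]] by (simp add: matrix_inv_def)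

definition parity_mat :: "complex poly \<Rightarrow> complex poly \<Rightarrow> complex \<Rightarrow> cmat2" where
  "parity_mat q q' \<zeta> =
     mat2 ((poly q \<zeta> + poly q (- \<zeta>)) / 2) ((poly q \<zeta> - poly q (- \<zeta>)) / (2 * \<zeta>))
          ((poly q' \<zeta> + poly q' (- \<zeta>)) / 2) ((poly q' \<zeta> - poly q' (- \<zeta>)) / (2 * \<zeta>))"

text \<open>The lower triangular factor removes $\beta$ from \<open>Emat\<close>; what remains has columns
  $(1, \pm\zeta)^T$ and reassembles a polynomial at $\pm\zeta$ from its parity parts.\<close>

lemma parity_mat_times_Emat:
  assumes "\<zeta> \<noteq> 0"
  shows "parity_mat q q' \<zeta> ** mat2 1 0 (- of_real \<beta>) 1 ** Emat \<beta> \<zeta> = Qmat q q' \<zeta>"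
  using assms
  by (simp add: vec_eq_iff forall_2 parity_mat_def Emat_def Qmat_def matrix_matrix_mult_def
      sum_2 vector_2)
     (simp add: field_simps)

lemma solve_Emat:
  assumes "\<zeta> \<noteq> 0" and A: "A ** Emat \<beta> \<zeta> = B ** Qmat q q' \<zeta>"
  shows "A = B ** Qmat q q' \<zeta> ** matrix_inv (Emat \<beta> \<zeta>)"
    and "A = B ** parity_mat q q' \<zeta> ** mat2 1 0 (- of_real \<beta>) 1"
proof -
  have cancel: "C = D ** matrix_inv (Emat \<beta> \<zeta>)" if "C ** Emat \<beta> \<zeta> = D" for C D
    using that matrix_inv_right[OF invertible_Emat[OF \<open>\<zeta> \<noteq> 0\<close>, of \<beta>]]
    by (metis matrix_mul_assoc matrix_mul_rid)
  show *: "A = B ** Qmat q q' \<zeta> ** matrix_inv (Emat \<beta> \<zeta>)"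
    by (rule cancel[OF A])
  have "B ** parity_mat q q' \<zeta> ** mat2 1 0 (- of_real \<beta>) 1 ** Emat \<beta> \<zeta> = B ** Qmat q q' \<zeta>"
    using parity_mat_times_Emat[OF \<open>\<zeta> \<noteq> 0\<close>] by (simp add: matrix_mul_assoc[symmetric])
  from cancel[OF this] show "A = B ** parity_mat q q' \<zeta> ** mat2 1 0 (- of_real \<beta>) 1"
    using * by simp
qed

lemma Qmat_shear: "Qmat q (q' + smult c q) \<zeta> = mat2 1 0 c 1 ** Qmat q q' \<zeta>"
  by (simp add: vec_eq_iff forall_2 Qmat_def matrix_matrix_mult_def sum_2 vector_2)

text \<open>The freedom that makes $q_{2k+1}$ non-unique: both polynomials are orthogonal to the same powers.\<close>

lemma scalar_orthogonal_add_smult: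
  assumes R: "\<bar>\<beta>\<bar> < R"
    and "scalar_orthogonal \<alpha> \<beta> K L R m q" "scalar_orthogonal \<alpha> \<beta> K L R m q'"
  shows "scalar_orthogonal \<alpha> \<beta> K L R m (q' + smult c q)"
proof -
  have R': "norm (of_real \<beta> :: complex) < R"
    using R by simp
  show ?thesis
    using assms unfolding scalar_orthogonal_iff[OF R]
    by (simp add: distrib_right node_functional_add[OF R'] node_functional_smult[OF R'])
qed

lemma monic_matpoly_row_polys:
  fixes p :: "2 \<Rightarrow> 2 \<Rightarrow> complex poly"
  assumes p: "\<And>i j. degree_less k (p i j - (if i = j then monom 1 k else 0))"
  shows "monic_poly (2 * k) (row_poly b (p 1 1) (p 1 2))"
    and "monic_poly (2 * k + 1) (row_poly b (p 2 1) (p 2 2))"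
proof -
  have "row_poly b (p 1 1) (p 1 2) - row_poly b (monom 1 k) 0 = row_poly b (p 1 1 - monom 1 k) (p 1 2)"
    using row_poly_add[of b "p 1 1 - monom 1 k" "p 1 2" "monom 1 k" 0] by (simp add: diff_eq_eq)
  then show "monic_poly (2 * k) (row_poly b (p 1 1) (p 1 2))"
    unfolding monic_poly_even_iff[of _ _ b] using p[of 1 1] p[of 1 2]
    by (simp add: degree_less_row_poly)
  have "row_poly b (p 2 1) (p 2 2) - row_poly b 0 (monom 1 k) = row_poly b (p 2 1) (p 2 2 - monom 1 k)"
    using row_poly_add[of b "p 2 1" "p 2 2 - monom 1 k" 0 "monom 1 k"] by (simp add: diff_eq_eq)
  then show "monic_poly (2 * k + 1) (row_poly b (p 2 1) (p 2 2))"
    using p[of 2 1] p[of 2 2]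
    by (intro conjunct1[OF iffD2[OF monic_poly_odd_iff[of k _ b]]]) (simp add: degree_less_row_poly)
qed

text \<open>After removal of the leading part the decomposition of polynomials of degree below $2k$ applies to
  each row.\<close>

lemma matpoly_of_scalar_polys:
  assumes "monic_poly (2 * k) q" "monic_poly (2 * k + 1) q'" "coeff q' (2 * k) = b"
  obtains P p where "monic_matpoly k P" "matpoly_entries P p"
    "q = row_poly b (p 1 1) (p 1 2)" "q' = row_poly b (p 2 1) (p 2 2)"
proof -
  obtain s t where st: "degree_less k s" "degree_less k t" "q - row_poly b (monom 1 k) 0 = row_poly b s t"
    using assms(1) monic_poly_even_iff degree_less_row_poly_exists by metis
  obtain u v where uv: "degree_less k u" "degree_less k v" "q' - row_poly b 0 (monom 1 k) = row_poly b u v"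
    using assms(2,3) monic_poly_odd_iff degree_less_row_poly_exists by metis
  define p :: "2 \<Rightarrow> 2 \<Rightarrow> complex poly" where
    "p i j = (if i = 1 then (if j = 1 then monom 1 k + s else t)
              else (if j = 1 then u else monom 1 k + v))" for i j
  define P :: "complex \<Rightarrow> cmat2" where "P z = (\<chi> i j. poly (p i j) z)" for z
  have "matpoly_entries P p"
    by (simp add: matpoly_entries_def P_def)
  moreover have "\<forall>i j. degree_less k (p i j - (if i = j then monom 1 k else 0))"
    using st uv by (simp add: forall_2 p_def)
  moreover have "q = row_poly b (p 1 1) (p 1 2)" "q' = row_poly b (p 2 1) (p 2 2)"
    using st(3) uv(3) by (simp_all add: p_def diff_eq_eq row_poly_add add.commute)
  ultimately show thesis
    using that monic_matpoly_iff by blast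
qed

theorem theorem1p2:
  fixes K L k :: nat and \<alpha> \<beta> :: real
    and \<gamma> :: "real \<Rightarrow> complex" and P :: "complex \<Rightarrow> complex^2^2"
  assumes "2 * int K - int L \<le> 2 * int k" and "2 * k \<le> 2 * K"
    and "\<alpha> > 0" and "\<beta> = (1 - \<alpha>) / 2"
    and "valid_path \<gamma>" and "pathfinish \<gamma> = pathstart \<gamma>"
    and "0 \<notin> path_image \<gamma>" and "winding_number \<gamma> 0 = 1"
    and P: "mvop \<alpha> K L \<gamma> k P"
    and P_unique: "\<And>Q. mvop \<alpha> K L \<gamma> k Q \<Longrightarrow> Q = P"
  shows "(\<exists>q q'. monic_poly (2 * k) q \<and> monic_poly (2 * k + 1) q' \<and>
           (\<forall>\<zeta>. P (\<zeta>\<^sup>2 - (of_real \<beta>)\<^sup>2) ** Emat \<beta> \<zeta> = Qmat q q' \<zeta>) \<and>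
           (\<forall>R>\<bar>\<beta>\<bar>. scalar_orthogonal \<alpha> \<beta> K L R (2 * k) q \<and>
                     scalar_orthogonal \<alpha> \<beta> K L R (2 * k) q')) \<and>
         (\<forall>R>\<bar>\<beta>\<bar>. \<forall>q q' c.
           monic_poly (2 * k) q \<and> monic_poly (2 * k + 1) q' \<and>
           scalar_orthogonal \<alpha> \<beta> K L R (2 * k) q \<and>
           scalar_orthogonal \<alpha> \<beta> K L R (2 * k) q' \<and>
           c = of_real \<beta> - 1 / (2 * of_real pi * \<i>) *
                 contour_integral \<gamma> (\<lambda>\<zeta>. poly q' \<zeta> / \<zeta> ^ (2 * k + 1)) \<longrightarrow>
           (\<forall>z \<zeta>. z + (of_real \<beta>)\<^sup>2 \<notin> \<real>\<^sub>\<le>\<^sub>0 \<and> \<zeta> = csqrt (z + (of_real \<beta>)\<^sup>2) \<longrightarrow>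
             invertible (Emat \<beta> \<zeta>) \<and>
             P z = mat2 1 0 c 1 ** Qmat q q' \<zeta> ** matrix_inv (Emat \<beta> \<zeta>) \<and>
             P z = mat2 1 0 c 1 **
               mat2 ((poly q \<zeta> + poly q (- \<zeta>)) / 2)   ((poly q \<zeta> - poly q (- \<zeta>)) / (2 * \<zeta>))
                    ((poly q' \<zeta> + poly q' (- \<zeta>)) / 2) ((poly q' \<zeta> - poly q' (- \<zeta>)) / (2 * \<zeta>)) **
               mat2 1 0 (- of_real \<beta>) 1))"
proof (intro conjI, goal_cases)
  note \<gamma> = assms(5-8)
  have "k \<le> K"
    using assms(2) by simp
  note iff = mvop_iff_scalar_orthogonal[OF \<open>k \<le> K\<close> assms(4) _ \<gamma>]
  let ?b = "of_real \<beta> :: complex"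
  case 1
  obtain p where p: "matpoly_entries P p"
    "\<And>i j. degree_less k (p i j - (if i = j then monom 1 k else 0))"
    using P monic_matpoly_iff by (auto simp: mvop_def)
  have "scalar_orthogonal \<alpha> \<beta> K L R (2 * k) (row_poly ?b (p i 1) (p i 2))" if "\<bar>\<beta>\<bar> < R" for R i
    using iff[OF that p(1)] P by blast
  then show ?case
    using monic_matpoly_row_polys[OF p(2), where b = ?b] matpoly_times_Emat[OF p(1)] by blast
next
  note \<gamma> = assms(5-8)
  have "k \<le> K"
    using assms(2) by simp
  note iff = mvop_iff_scalar_orthogonal[OF \<open>k \<le> K\<close> assms(4) _ \<gamma>]
  let ?b = "of_real \<beta> :: complex"
  case 2
  show ?case
    unfolding parity_mat_def[symmetric]
  proof (intro allI impI, elim conjE)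
    fix R q q' c z \<zeta>
    assume R: "\<bar>\<beta>\<bar> < R" and q: "monic_poly (2 * k) q" and q': "monic_poly (2 * k + 1) q'"
      and orth: "scalar_orthogonal \<alpha> \<beta> K L R (2 * k) q" "scalar_orthogonal \<alpha> \<beta> K L R (2 * k) q'"
      and c: "c = ?b - 1 / (2 * of_real pi * \<i>) *
                contour_integral \<gamma> (\<lambda>\<zeta>. poly q' \<zeta> / \<zeta> ^ (2 * k + 1))"
      and z: "z + ?b\<^sup>2 \<notin> \<real>\<^sub>\<le>\<^sub>0" and \<zeta>: "\<zeta> = csqrt (z + ?b\<^sup>2)"
    \<comment> \<open>Adding \<open>smult c q\<close> to \<open>q'\<close> brings the coefficient at $2k$ to $\beta$ because \<open>q\<close> is monic.\<close>
    have "c = ?b - coeff q' (2 * k)"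
      using contour_integral_coeff_winding_1[OF \<gamma>, of q' "2 * k"] by (simp add: c)
    then have "coeff (q' + smult c q) (2 * k) = ?b" "monic_poly (2 * k + 1) (q' + smult c q)"
      using q q' by (auto simp: monic_poly_iff_coeffs degree_less_def)
    then obtain Q p where Q: "monic_matpoly k Q" "matpoly_entries Q p"
      and rows: "q = row_poly ?b (p 1 1) (p 1 2)" "q' + smult c q = row_poly ?b (p 2 1) (p 2 2)"
      using matpoly_of_scalar_polys[OF q] by metis
    have "mvop \<alpha> K L \<gamma> k Q"
      unfolding iff[OF R Q(2)] forall_2 rows[symmetric]
      using Q(1) orth scalar_orthogonal_add_smult[OF R] by blast
    then have "Q = P"
      by (rule P_unique)
    have "\<zeta> \<noteq> 0"
      using z \<zeta> by auto
    have "z = \<zeta>\<^sup>2 - ?b\<^sup>2"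
      by (simp add: \<zeta>)
    then have "P z ** Emat \<beta> \<zeta> = mat2 1 0 c 1 ** Qmat q q' \<zeta>"
      using matpoly_times_Emat[OF Q(2), of \<zeta> \<beta>] \<open>Q = P\<close>
      by (simp add: rows[symmetric] Qmat_shear)
    with \<open>\<zeta> \<noteq> 0\<close> show "invertible (Emat \<beta> \<zeta>) \<and>
        P z = mat2 1 0 c 1 ** Qmat q q' \<zeta> ** matrix_inv (Emat \<beta> \<zeta>) \<and>
        P z = mat2 1 0 c 1 ** parity_mat q q' \<zeta> ** mat2 1 0 (- ?b) 1"
      by (intro conjI invertible_Emat solve_Emat)
  qed
qed

end
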